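(* Let $X_1,\dots,X_n$ be an i.i.d. sample from a distribution $P$, and let $\mu\in\mathcal{M}$ be a certain characteristic of $P$ (a fixed point determined by $P$), where $(\mathcal{M},d)$ is a complete separable metric space. Let $\delta\in(0,1)$ and $K=\lceil 8\log(\delta^{-1})\rceil$, and assume that $n/K=\ell\in\mathbb{N}$, $\ell\ge 1$. Split the sample into $K$ disjoint groups of size $\ell$, and let $\mu_1,\dots,\mu_K$ be the $K$ estimators of $\mu$, with values in $\mathcal{M}$, obtained from the respective groups. Let $j^*\in\{1,\dots,K\}$ be a minimizer over $j\in\{1,\dots,K\}$ of $$j\mapsto \min_{I\subset\{1,\dots,K\}:\,|I|>K/2}\ \max_{i\in I} d(\mu_i,\mu_j).$$ Then $$\mathbb{P}\left(d(\mu_{j^*},\mu)>6\sqrt{\mathbb{E}\, d^2(\mu_1,\mu)}\right)\le\delta .$$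
   Context: The estimators $\mu_1,\dots,\mu_K$ are obtained by applying the same estimation procedure (a measurable $\mathcal{M}$-valued function of $\ell$ observations) to each of the $K$ disjoint groups, so they are independent and identically distributed random elements of $\mathcal{M}$. The minimizer need not be unique; $j^*$ is an arbitrarily chosen (random) minimizing index. $\log$ is the natural logarithm, $\lceil x\rceil$ the ceiling of $x$, and $d^2(a,b)=d(a,b)^2$. *)

theory Defs
  imports "HOL-Probability.Probability"
begin

(* Square root on [0, \<infinity>], so that an estimator with infinite mean squared error has
   root mean squared error \<infinity> (the Bochner integral would give 0 instead). *)
definition ennsqrt :: "ennreal \<Rightarrow> ennreal" where
  "ennsqrt x = (if x = \<top> then \<top> else ennreal (sqrt (enn2real x)))"

lemma ennsqrt_power2: "ennsqrt x ^ 2 = x"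
  by (cases x) (auto simp: ennsqrt_def ennreal_power)

(* K is the number of groups. For every j in {1..K} the outer minimum and the inner
   maxima are taken over finite nonempty sets as soon as K > 0. *)
definition median_radius :: "nat \<Rightarrow> (nat \<Rightarrow> 'm :: metric_space) \<Rightarrow> nat \<Rightarrow> real" where
  "median_radius K m j =
     Min ((\<lambda>I. Max ((\<lambda>i. dist (m i) (m j)) ` I)) ` {I. I \<subseteq> {1..K} \<and> real (card I) > real K / 2})"

(* The observations entering group j are X (e j 1), ..., X (e j l), in this order;
   T is the common estimation procedure. *)
definition group_estimator ::
  "((nat \<Rightarrow> 'x) \<Rightarrow> 'm) \<Rightarrow> nat \<Rightarrow> (nat \<Rightarrow> nat \<Rightarrow> nat) \<Rightarrow> (nat \<Rightarrow> 'w \<Rightarrow> 'x) \<Rightarrow> nat \<Rightarrow> 'w \<Rightarrow> 'm" where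
  "group_estimator T l e X j \<omega> = T (\<lambda>i\<in>{1..l}. X (e j i) \<omega>)"

end

theory Submission
  imports Defs
begin

text \<open>
  Let \<open>\<sigma>\<^sup>2\<close> be the mean squared error of one estimator. By Chebyshev's inequality each estimator
  misses the ball of radius \<open>2 \<sigma>\<close> around \<open>\<mu>\<close> with probability at most \<open>1/4\<close>, so by independence
  and Hoeffding's inequality at least half of them miss it with probability at most
  \<open>exp (- K / 8) \<le> \<delta>\<close>. Otherwise a strict majority lies in the ball; any of its members has median
  radius at most \<open>4 \<sigma>\<close>, hence so has the minimizer, and the two majorities meet in an
  estimator within \<open>2 \<sigma>\<close> of \<open>\<mu>\<close> and within \<open>4 \<sigma>\<close> of the minimizer.
\<close>

section \<open>Deterministic geometry of the median radius\<close>

lemma median_radius_le: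
  assumes "I \<subseteq> {1..K}" "real (card I) > real K / 2" "\<And>i. i \<in> I \<Longrightarrow> dist (m i) (m j) \<le> r"
  shows "median_radius K m j \<le> r"
proof -
  let ?S = "{I. I \<subseteq> {1..K} \<and> real (card I) > real K / 2}"
  have fin: "finite ?S" by (rule finite_subset[of _ "Pow {1..K}"]) auto
  have "I \<noteq> {}" "finite I" using assms(1,2) finite_subset by auto
  have "median_radius K m j \<le> Max ((\<lambda>i. dist (m i) (m j)) ` I)"
    unfolding median_radius_def using fin assms(1,2) by (intro Min_le) auto
  also have "\<dots> \<le> r"
    using \<open>I \<noteq> {}\<close> \<open>finite I\<close> assms(3) by (subst Max_le_iff) auto
  finally show ?thesis .
qed

lemma median_radius_attained:
  assumes "K > 0"
  obtains I where "I \<subseteq> {1..K}" "real (card I) > real K / 2"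
    "\<And>i. i \<in> I \<Longrightarrow> dist (m i) (m j) \<le> median_radius K m j"
proof -
  let ?S = "{I. I \<subseteq> {1..K} \<and> real (card I) > real K / 2}"
  let ?F = "\<lambda>I. Max ((\<lambda>i. dist (m i) (m j)) ` I)"
  have "finite ?S" by (rule finite_subset[of _ "Pow {1..K}"]) auto
  moreover have "{1..K} \<in> ?S" using assms by auto
  ultimately have "median_radius K m j \<in> ?F ` ?S"
    unfolding median_radius_def by (intro Min_in) auto
  then obtain I where I: "I \<in> ?S" "median_radius K m j = ?F I" by blast
  then have "finite I" using finite_subset by auto
  with I show thesis by (intro that[of I]) auto
qed

text \<open>The statement concerns one realization of the estimators. The factor 3 is
  \<open>2 * r\<close> for the median radius of the minimizer plus \<open>r\<close> for a point
  shared by two strict majorities.\<close>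

lemma dist_median_minimizer_le:
  fixes m :: "nat \<Rightarrow> 'm :: metric_space"
  assumes majority: "real (card {i \<in> {1..K}. dist (m i) \<mu> \<le> r}) > real K / 2"
    and min: "is_arg_min (median_radius K m) (\<lambda>j. j \<in> {1..K}) j"
  shows "dist (m j) \<mu> \<le> 3 * r"
proof -
  define G where "G = {i \<in> {1..K}. dist (m i) \<mu> \<le> r}"
  have G: "G \<subseteq> {1..K}" "real (card G) > real K / 2"
    using majority by (auto simp: G_def)
  then obtain g where g: "g \<in> G" by fastforce
  have "median_radius K m g \<le> 2 * r"
  proof (rule median_radius_le[OF G])
    fix i assume "i \<in> G"
    with g show "dist (m i) (m g) \<le> 2 * r"
      using dist_triangle2[of "m i" "m g" \<mu>] by (auto simp: G_def)
  qed
  \<comment> \<open>The good index \<open>g\<close> is an admissible competitor, so the minimizer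
    inherits its bound.\<close>
  with min g G have j: "median_radius K m j \<le> 2 * r"
    by (force simp: is_arg_min_linorder)
  have "K > 0" using g G by auto
  then obtain I where I: "I \<subseteq> {1..K}" "real (card I) > real K / 2"
      "\<And>i. i \<in> I \<Longrightarrow> dist (m i) (m j) \<le> median_radius K m j"
    using median_radius_attained by blast
  \<comment> \<open>Two disjoint sets of size above K/2 would have more than K elements
    together.\<close>
  have "G \<inter> I \<noteq> {}"
  proof
    assume "G \<inter> I = {}"
    then have "card G + card I = card (G \<union> I)"
      using G(1) I(1) by (intro card_Un_disjoint[symmetric]) (auto intro: finite_subset)
    also have "\<dots> \<le> card {1..K}" using G(1) I(1) by (intro card_mono) auto
    finally show False using G(2) I(2) by simp
  qed
  then obtain i where "i \<in> G" "i \<in> I" by blast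
  with I(3)[of i] j show ?thesis
    using dist_triangle3[of "m j" \<mu> "m i"] by (auto simp: G_def)
qed

section \<open>Tail bounds for a single estimator and for the count of bad estimators\<close>

lemma (in prob_space) Chebyshev_nn_integral:
  fixes g :: "'a \<Rightarrow> real"
  assumes [measurable]: "g \<in> borel_measurable M" and "\<And>x. g x \<ge> 0"
    and int: "(\<integral>\<^sup>+x. ennreal ((g x)\<^sup>2) \<partial>M) = ennreal (\<sigma>\<^sup>2)" and "\<sigma> \<ge> 0" "c > 0"
  shows "prob {x \<in> space M. g x > c * \<sigma>} \<le> 1 / c\<^sup>2"
proof (cases "\<sigma> = 0")
  \<comment> \<open>Division by \<open>c * \<sigma>\<close> is meaningless here; instead a vanishing
    second moment forces \<open>g\<close> to be zero almost everywhere.\<close>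
  case True
  with int have "AE x in M. ennreal ((g x)\<^sup>2) = 0"
    by (subst nn_integral_0_iff_AE[symmetric]) auto
  then have "AE x in M. \<not> g x > c * \<sigma>"
    by eventually_elim (auto simp: True)
  then have "prob {x \<in> space M. g x > c * \<sigma>} = 0"
    by (intro prob_eq_0[THEN iffD2]) auto
  then show ?thesis by simp
next
  case False
  \<comment> \<open>This weight turns the event into \<open>1 \<le> a * (g x)\<^sup>2\<close>, the
    form of Markov's inequality, and scales the second moment to
    \<open>1 / c\<^sup>2\<close>.\<close>
  define a where "a = 1 / (c * \<sigma>)\<^sup>2"
  have pos: "c * \<sigma> > 0" "a > 0" using False assms by (auto simp: a_def)
  have "emeasure M {x \<in> space M. g x > c * \<sigma>}
      \<le> emeasure M {x \<in> space M. 1 \<le> ennreal a * ennreal ((g x)\<^sup>2)}"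
  proof (intro emeasure_mono subsetI)
    fix x assume x: "x \<in> {x \<in> space M. g x > c * \<sigma>}"
    then have "(c * \<sigma>)\<^sup>2 \<le> (g x)\<^sup>2" using pos by (intro power_mono) auto
    then have "1 \<le> a * (g x)\<^sup>2" using pos by (simp add: a_def field_simps)
    then show "x \<in> {x \<in> space M. 1 \<le> ennreal a * ennreal ((g x)\<^sup>2)}"
      using x pos by (simp flip: ennreal_mult)
  qed auto
  also have "\<dots> \<le> ennreal a * (\<integral>\<^sup>+x. ennreal ((g x)\<^sup>2) * indicator (space M) x \<partial>M)"
    by (intro nn_integral_Markov_inequality) auto
  also have "(\<integral>\<^sup>+x. ennreal ((g x)\<^sup>2) * indicator (space M) x \<partial>M) = ennreal (\<sigma>\<^sup>2)"
    unfolding int[symmetric] by (intro nn_integral_cong) auto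
  also have "ennreal a * ennreal (\<sigma>\<^sup>2) = ennreal (1 / c\<^sup>2)"
    using pos False \<open>c > 0\<close> by (simp add: a_def power_mult_distrib flip: ennreal_mult)
  finally show ?thesis
    by (simp add: emeasure_eq_measure)
qed

text \<open>The count is a sum of independent indicators with mean at most
  \<open>p * card I\<close>, so reaching \<open>q * card I\<close> is a deviation of at least
  \<open>(q - p) * card I\<close>, to which Hoeffding's inequality applies.\<close>

lemma (in prob_space) Hoeffding_count_ge:
  fixes p q :: real
  assumes "finite I" "I \<noteq> {}"
    and ind: "indep_vars N Y I"
    and B: "\<And>i. i \<in> I \<Longrightarrow> B i \<in> sets (N i)"
    and p: "\<And>i. i \<in> I \<Longrightarrow> prob (Y i -` B i \<inter> space M) \<le> p"
    and "p \<le> q"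
  shows "prob {x \<in> space M. real (card {i \<in> I. Y i x \<in> B i}) \<ge> q * real (card I)}
           \<le> exp (- 2 * real (card I) * (q - p)\<^sup>2)"
proof -
  define Z where "Z i x = (indicator (B i) (Y i x) :: real)" for i x
  define m where "m = (\<Sum>i\<in>I. expectation (Z i))"
  have Y: "Y i \<in> M \<rightarrow>\<^sub>M N i" if "i \<in> I" for i
    using ind that by (auto simp: indep_vars_def)
  have "indep_vars (\<lambda>_. borel) Z I"
    unfolding Z_def using B by (intro indep_vars_compose2[OF ind] borel_measurable_indicator)
  then interpret Hoeffding_ineq M I Z "\<lambda>_. 0" "\<lambda>_. 1" m
    by unfold_locales (auto simp: \<open>finite I\<close> m_def Z_def indicator_def)
  have "expectation (Z i) \<le> p" if "i \<in> I" for i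
  proof -
    have "expectation (Z i) = expectation (indicator (Y i -` B i \<inter> space M))"
      by (intro Bochner_Integration.integral_cong) (auto simp: Z_def indicator_def)
    with p[OF that] show ?thesis using measurable_sets[OF Y[OF that] B[OF that]] by simp
  qed
  then have m: "m \<le> real (card I) * p"
    unfolding m_def using sum_bounded_above[of I "\<lambda>i. expectation (Z i)" p] by simp
  have n: "real (card I) > 0" using assms by (simp add: card_gt_0_iff)
  have eq: "real (card {i \<in> I. Y i x \<in> B i}) = (\<Sum>i\<in>I. Z i x)" for x
    using \<open>finite I\<close> by (simp add: Z_def indicator_def sum.If_cases Int_def)
  have "prob {x \<in> space M. real (card {i \<in> I. Y i x \<in> B i}) \<ge> q * real (card I)}
      \<le> prob {x \<in> space M. (\<Sum>i\<in>I. Z i x) \<ge> m + real (card I) * (q - p)}"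
    using m by (intro finite_measure_mono) (auto simp: eq algebra_simps)
  also have "\<dots> \<le> exp (- 2 * (real (card I) * (q - p))\<^sup>2 / (\<Sum>i\<in>I. (1 - 0)\<^sup>2))"
    using n \<open>p \<le> q\<close> by (intro Hoeffding_ineq_ge) auto
  \<comment> \<open>Each indicator has range 1, so the denominator is \<open>card I\<close> and
    cancels one power.\<close>
  also have "- 2 * (real (card I) * (q - p))\<^sup>2 / (\<Sum>i\<in>I. (1 - 0)\<^sup>2) = - 2 * real (card I) * (q - p)\<^sup>2"
    using n by (simp add: power_mult_distrib power2_eq_square)
  finally show ?thesis .
qed

text \<open>The whole family has a product law with equal factors, and pulling coordinates back
  along an injection preserves such a law. With \<open>f\<close> the enumeration of a group, all
  groups get the same joint law.\<close>

lemma (in prob_space) distr_iid_reindex: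
  assumes ind: "indep_vars (\<lambda>_. N) X J" and id: "\<And>i. i \<in> J \<Longrightarrow> distr M N (X i) = N"
    and "prob_space N" and f: "inj_on f I" "f \<in> I \<rightarrow> J" and "I \<noteq> {}"
  shows "distr M (PiM I (\<lambda>_. N)) (\<lambda>\<omega>. \<lambda>i\<in>I. X (f i) \<omega>) = PiM I (\<lambda>_. N)"
proof -
  have X: "X i \<in> M \<rightarrow>\<^sub>M N" if "i \<in> J" for i
    using ind that by (auto simp: indep_vars_def)
  have "J \<noteq> {}" using f \<open>I \<noteq> {}\<close> by auto
  then have "distr M (PiM J (\<lambda>_. N)) (\<lambda>\<omega>. \<lambda>i\<in>J. X i \<omega>) = PiM J (\<lambda>i. distr M N (X i))"
    using indep_vars_iff_distr_eq_PiM'[where M' = "\<lambda>_. N" and X = X and I = J] ind X by simp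
  also have "\<dots> = PiM J (\<lambda>_. N)" by (intro PiM_cong) (auto simp: id)
  finally have J: "distr M (PiM J (\<lambda>_. N)) (\<lambda>\<omega>. \<lambda>i\<in>J. X i \<omega>) = PiM J (\<lambda>_. N)" .
  have "(\<lambda>\<omega>. \<lambda>i\<in>I. X (f i) \<omega>) = (\<lambda>g. \<lambda>i\<in>I. g (f i)) \<circ> (\<lambda>\<omega>. \<lambda>i\<in>J. X i \<omega>)"
    using f by (auto simp: fun_eq_iff restrict_def)
  then have "distr M (PiM I (\<lambda>_. N)) (\<lambda>\<omega>. \<lambda>i\<in>I. X (f i) \<omega>)
      = distr (distr M (PiM J (\<lambda>_. N)) (\<lambda>\<omega>. \<lambda>i\<in>J. X i \<omega>)) (PiM I (\<lambda>_. N)) (\<lambda>g. \<lambda>i\<in>I. g (f i))"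
    using X f by (subst distr_distr) (auto intro!: measurable_restrict measurable_component_singleton)
  also have "\<dots> = PiM I (\<lambda>_. N)"
    unfolding J using distr_PiM_reindex[of J "\<lambda>_. N" f I] f \<open>prob_space N\<close> by simp
  finally show ?thesis .
qed

theorem theorem5:
  fixes M :: "'w measure" and P :: "'x measure"
    and X :: "nat \<Rightarrow> 'w \<Rightarrow> 'x"
    and T :: "(nat \<Rightarrow> 'x) \<Rightarrow> 'm :: polish_space"
    and e :: "nat \<Rightarrow> nat \<Rightarrow> nat"
    and \<mu> :: 'm and \<mu>' :: "nat \<Rightarrow> 'w \<Rightarrow> 'm"
    and jstar :: "'w \<Rightarrow> nat"
    and n K l :: nat and \<delta> :: real
  assumes "prob_space M"
    and "prob_space P"
    and "prob_space.indep_vars M (\<lambda>_. P) X {1..n}"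
    and "\<And>i. i \<in> {1..n} \<Longrightarrow> distr M P (X i) = P"
    and "0 < \<delta>" and "\<delta> < 1"
    and "int K = \<lceil>8 * ln (1 / \<delta>)\<rceil>"
    and "real n / real K = real l" and "l \<ge> 1"
    and "bij_betw (\<lambda>(j, i). e j i) ({1..K} \<times> {1..l}) {1..n}"
    and "T \<in> PiM {1..l} (\<lambda>_. P) \<rightarrow>\<^sub>M borel"
    and "\<mu>' = group_estimator T l e X"
    and "jstar \<in> M \<rightarrow>\<^sub>M count_space {1..K}"
    and "\<And>\<omega>. \<omega> \<in> space M \<Longrightarrow>
           is_arg_min (median_radius K (\<lambda>i. \<mu>' i \<omega>)) (\<lambda>j. j \<in> {1..K}) (jstar \<omega>)"
  shows "measure M {\<omega> \<in> space M.
            ennreal (dist (\<mu>' (jstar \<omega>) \<omega>) \<mu>) >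
              6 * ennsqrt (\<integral>\<^sup>+ \<omega>'. ennreal ((dist (\<mu>' 1 \<omega>') \<mu>)\<^sup>2) \<partial>M)} \<le> \<delta>"
proof -
  interpret prob_space M by fact
  have [measurable]: "T \<in> PiM {1..l} (\<lambda>_. P) \<rightarrow>\<^sub>M borel" by fact
  note \<mu>'_eq = assms(12)
  have "1 / \<delta> > 1" using \<open>0 < \<delta>\<close> \<open>\<delta> < 1\<close> by simp
  \<comment> \<open>Both follow from the ceiling; positivity uses that the logarithm is positive for
    \<delta> < 1.\<close>
  then have K_ge: "8 * ln (1 / \<delta>) \<le> real K" and "K > 0"
    using assms(7) by linarith (use assms(7) \<open>1 / \<delta> > 1\<close> ln_gt_zero[of "1 / \<delta>"] in linarith)
  have e_inj: "inj_on (\<lambda>(j, i). e j i) ({1..K} \<times> {1..l})"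
    and e_img: "(\<lambda>(j, i). e j i) ` ({1..K} \<times> {1..l}) = {1..n}"
    using assms(10) by (auto simp: bij_betw_def)
  have e_in: "e j i \<in> {1..n}" if "j \<in> {1..K}" "i \<in> {1..l}" for j i
    using e_img that by force
  \<comment> \<open>Injectivity of \<open>e\<close> on pairs makes the index blocks disjoint, so the
    blocks of observations are independent; each estimator is then a measurable function of its own
    block.\<close>
  have "indep_vars (\<lambda>j. PiM (e j ` {1..l}) (\<lambda>_. P))
          (\<lambda>j \<omega>. \<lambda>k\<in>e j ` {1..l}. X k \<omega>) {1..K}"
  proof (rule indep_vars_restrict[OF assms(3)])
    show "disjoint_family_on (\<lambda>j. e j ` {1..l}) {1..K}"
      unfolding disjoint_family_on_def
    proof (intro ballI impI, rule ccontr)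
      fix j j' assume j: "j \<in> {1..K}" "j' \<in> {1..K}" "j \<noteq> j'"
        and "e j ` {1..l} \<inter> e j' ` {1..l} \<noteq> {}"
      then obtain i i' where "i \<in> {1..l}" "i' \<in> {1..l}" "e j i = e j' i'" by blast
      with j inj_onD[OF e_inj, of "(j, i)" "(j', i')"] show False by auto
    qed
  qed (use e_in in blast)
  then have "indep_vars (\<lambda>_. borel)
      (\<lambda>j \<omega>. T (\<lambda>i\<in>{1..l}. (\<lambda>k\<in>e j ` {1..l}. X k \<omega>) (e j i))) {1..K}"
    by (rule indep_vars_compose2)
       (intro measurable_compose[OF _ assms(11)] measurable_restrict
         measurable_component_singleton imageI)
  also have "(\<lambda>j \<omega>. T (\<lambda>i\<in>{1..l}. (\<lambda>k\<in>e j ` {1..l}. X k \<omega>) (e j i))) = \<mu>'"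
    by (auto simp: \<mu>'_eq group_estimator_def fun_eq_iff intro!: arg_cong[where f = T])
  finally have ind: "indep_vars (\<lambda>_. borel) \<mu>' {1..K}" .
  then have \<mu>'_measurable [measurable]: "\<mu>' j \<in> borel_measurable M" if "j \<in> {1..K}" for j
    using that by (auto simp: indep_vars_def)

  define V where "V = (\<integral>\<^sup>+\<omega>. ennreal ((dist (\<mu>' 1 \<omega>) \<mu>)\<^sup>2) \<partial>M)"
  \<comment> \<open>The right-hand side is free of \<open>j\<close>, so all estimators share the
    mean squared error \<open>V\<close> of the first.\<close>
  have law: "(\<integral>\<^sup>+\<omega>. ennreal ((dist (\<mu>' j \<omega>) \<mu>)\<^sup>2) \<partial>M)
      = (\<integral>\<^sup>+x. ennreal ((dist (T x) \<mu>)\<^sup>2) \<partial>PiM {1..l} (\<lambda>_. P))" if j: "j \<in> {1..K}" for j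
  proof -
    have X: "X (e j i) \<in> M \<rightarrow>\<^sub>M P" if "i \<in> {1..l}" for i
      using assms(3) e_in[OF j that] by (auto simp: indep_vars_def)
    have "inj_on (e j) {1..l}" 
      using j inj_onD[OF e_inj, of "(j, i)" "(j, i')" for i i'] by (auto intro!: inj_onI)
    then have "PiM {1..l} (\<lambda>_. P) = distr M (PiM {1..l} (\<lambda>_. P)) (\<lambda>\<omega>. \<lambda>i\<in>{1..l}. X (e j i) \<omega>)"
      using assms(2-4,9) e_in[OF j]
      by (intro distr_iid_reindex[symmetric, where J = "{1..n}"]) auto
    then have "(\<integral>\<^sup>+x. ennreal ((dist (T x) \<mu>)\<^sup>2) \<partial>PiM {1..l} (\<lambda>_. P))
      = (\<integral>\<^sup>+x. ennreal ((dist (T x) \<mu>)\<^sup>2)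
           \<partial>distr M (PiM {1..l} (\<lambda>_. P)) (\<lambda>\<omega>. \<lambda>i\<in>{1..l}. X (e j i) \<omega>))"
      by simp
    also have "\<dots> = (\<integral>\<^sup>+\<omega>. ennreal ((dist (\<mu>' j \<omega>) \<mu>)\<^sup>2) \<partial>M)"
      unfolding \<mu>'_eq group_estimator_def
    proof (rule nn_integral_distr)
      show "(\<lambda>\<omega>. \<lambda>i\<in>{1..l}. X (e j i) \<omega>) \<in> M \<rightarrow>\<^sub>M PiM {1..l} (\<lambda>_. P)"
        using X by (rule measurable_restrict)
      show "(\<lambda>x. ennreal ((dist (T x) \<mu>)\<^sup>2)) \<in> borel_measurable
          (distr M (PiM {1..l} (\<lambda>_. P)) (\<lambda>\<omega>. \<lambda>i\<in>{1..l}. X (e j i) \<omega>))"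
        unfolding measurable_distr_eq1 by measurable
    qed
    finally show ?thesis ..
  qed
  have V: "(\<integral>\<^sup>+\<omega>. ennreal ((dist (\<mu>' j \<omega>) \<mu>)\<^sup>2) \<partial>M) = V" if "j \<in> {1..K}" for j
    using law[OF that] law[of 1] \<open>K > 0\<close> by (simp add: V_def)

  show ?thesis
  proof (cases "V = \<top>")
    \<comment> \<open>The threshold is infinite, so the event is empty.\<close>
    case True
    then show ?thesis
      using \<open>0 < \<delta>\<close> by (simp add: V_def ennsqrt_def ennreal_mult_top)
  next
    case False
    define \<sigma> where "\<sigma> = sqrt (enn2real V)"
    have \<sigma>: "\<sigma> \<ge> 0" "V = ennreal (\<sigma>\<^sup>2)" "ennsqrt V = ennreal \<sigma>"
      using False by (auto simp: \<sigma>_def ennsqrt_def less_top)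
    \<comment> \<open>Radius \<open>2 * \<sigma>\<close> gives the Chebyshev bound 1/4, and tripling
      it gives the threshold \<open>6 * \<sigma>\<close>.\<close>
    define B where "B = {x. dist x \<mu> > 2 * \<sigma>}"
    have [measurable]: "B \<in> sets borel" unfolding B_def by measurable
    have "prob (\<mu>' j -` B \<inter> space M) \<le> 1 / 4" if j: "j \<in> {1..K}" for j
    proof -
      have "prob {\<omega> \<in> space M. dist (\<mu>' j \<omega>) \<mu> > 2 * \<sigma>} \<le> 1 / 2\<^sup>2"
        using V[OF j] \<sigma> \<mu>'_measurable[OF j] by (intro Chebyshev_nn_integral) auto
      also have "{\<omega> \<in> space M. dist (\<mu>' j \<omega>) \<mu> > 2 * \<sigma>} = \<mu>' j -` B \<inter> space M"
        by (auto simp: B_def)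
      finally show ?thesis by simp
    qed
    \<comment> \<open>With p = 1/4 and q = 1/2 the exponent is -K/8, which explains the 8 in the
      choice of K.\<close>
    then have count: "prob {\<omega> \<in> space M. real (card {j \<in> {1..K}. \<mu>' j \<omega> \<in> B}) \<ge> 1 / 2 * real (card {1..K})}
        \<le> exp (- 2 * real (card {1..K}) * (1 / 2 - 1 / 4)\<^sup>2)"
      using \<open>K > 0\<close> by (intro Hoeffding_count_ge[OF _ _ ind]) auto
    have "prob {\<omega> \<in> space M. ennreal (dist (\<mu>' (jstar \<omega>) \<omega>) \<mu>) > 6 * ennsqrt V}
        \<le> prob {\<omega> \<in> space M. real (card {j \<in> {1..K}. \<mu>' j \<omega> \<in> B}) \<ge> 1 / 2 * real (card {1..K})}"
    proof (intro finite_measure_mono subsetI)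
      fix \<omega> assume "\<omega> \<in> {\<omega> \<in> space M. ennreal (dist (\<mu>' (jstar \<omega>) \<omega>) \<mu>) > 6 * ennsqrt V}"
      then have \<omega>: "\<omega> \<in> space M" and "ennreal (dist (\<mu>' (jstar \<omega>) \<omega>) \<mu>) > ennreal (6 * \<sigma>)"
        using \<sigma> by (auto simp: ennreal_mult)
      then have far: "dist (\<mu>' (jstar \<omega>) \<omega>) \<mu> > 6 * \<sigma>"
        using \<sigma>(1) by (simp add: ennreal_less_iff)
      have "\<not> real (card {j \<in> {1..K}. dist (\<mu>' j \<omega>) \<mu> \<le> 2 * \<sigma>}) > real K / 2"
        using dist_median_minimizer_le[OF _ assms(14)[OF \<omega>], of \<mu> "2 * \<sigma>"] far by auto
      \<comment> \<open>The two counts are complementary: no strict majority inside the ball means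
        at least K/2 estimators in \<open>B\<close>.\<close>
      moreover have "card {j \<in> {1..K}. dist (\<mu>' j \<omega>) \<mu> \<le> 2 * \<sigma>}
          + card {j \<in> {1..K}. \<mu>' j \<omega> \<in> B} = K"
      proof -
        have "card {1..K} = card ({j \<in> {1..K}. dist (\<mu>' j \<omega>) \<mu> \<le> 2 * \<sigma>} \<union> {j \<in> {1..K}. \<mu>' j \<omega> \<in> B})"
          by (rule arg_cong[where f = card]) (auto simp: B_def)
        also have "\<dots> = card {j \<in> {1..K}. dist (\<mu>' j \<omega>) \<mu> \<le> 2 * \<sigma>}
            + card {j \<in> {1..K}. \<mu>' j \<omega> \<in> B}"
          by (rule card_Un_disjoint) (auto simp: B_def)
        finally show ?thesis by simp
      qed
      ultimately show "\<omega> \<in> {\<omega> \<in> space M. real (card {j \<in> {1..K}. \<mu>' j \<omega> \<in> B}) \<ge> 1 / 2 * real (card {1..K})}"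
        using \<omega> by auto
    next
      \<comment> \<open>Monotonicity of the measure asks for measurability of the larger event; the
        count is a finite sum of measurable indicators.\<close>
      show "{\<omega> \<in> space M. real (card {j \<in> {1..K}. \<mu>' j \<omega> \<in> B}) \<ge> 1 / 2 * real (card {1..K})} \<in> events"
      proof -
        have "real (card {j \<in> {1..K}. \<mu>' j \<omega> \<in> B}) = (\<Sum>j\<in>{1..K}. indicator B (\<mu>' j \<omega>))" for \<omega>
          by (simp add: indicator_def sum.If_cases Int_def)
        moreover have "(\<lambda>\<omega>. \<Sum>j\<in>{1..K}. indicator B (\<mu>' j \<omega>) :: real) \<in> borel_measurable M"
          by (intro borel_measurable_sum) measurable
        ultimately show ?thesis by (simp only:) measurable
      qed
    qed
    also note count
    also have "exp (- 2 * real (card {1..K}) * (1 / 2 - 1 / 4)\<^sup>2) \<le> \<delta>"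
    proof -
      have "- (real K / 8) \<le> ln \<delta>" using K_ge \<open>0 < \<delta>\<close> by (simp add: ln_div)
      then have "exp (- (real K / 8)) \<le> \<delta>" using \<open>0 < \<delta>\<close> by (simp add: ln_ge_iff)
      then show ?thesis by (simp add: power2_eq_square)
    qed
    finally show ?thesis by (simp add: V_def)
  qed
qed

end
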